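(* Let $n\ge 2$ and $m\ge1$ be integers, let $f:\mathbb{R}^{mn}\to\mathbb{R}$ be multi-affine, and let $\Omega_1,\dots,\Omega_n\subseteq\mathbb{R}^m$ be polyhedra. Put $\Omega_i^+=\Omega_i\cap\mathbb{R}^m_+$ and assume that $\Omega=\prod_{i=1}^n\Omega_i^+$ is nonempty and compact. Then there exists $\bar\beta>0$ such that $$\bar S_\beta^{\mathrm{opt}}\subseteq S^{\mathrm{opt}}\subseteq S_\beta^{\mathrm{opt}}\quad\text{for all }\beta\ge\bar\beta,\qquad( * )$$ and for any $\bar\beta>0$ satisfying $( * )$ and any $\beta\ge\bar\beta$ one has $$S_\beta^{\mathrm{opt}}=S^{\mathrm{opt}}.$$
   Context: Write $\mathbf{z}=(\mathbf{x}_1,\dots,\mathbf{x}_n)\in\mathbb{R}^{mn}$ with blocks $\mathbf{x}_i\in\mathbb{R}^m$. A function $f:\mathbb{R}^{mn}\to\mathbb{R}$ is multi-affine if, for each $i$, it is affine in $\mathbf{x}_i$ when the other $n-1$ blocks are fixed. A polyhedron is the solution set of finitely many (non-strict) linear inequalities. $\mathbb{R}^m_+$ is the nonnegative orthant. Penalty term: $p(\mathbf{z})=\sum_{i=1}^n\sum_{j>i}\langle\mathbf{x}_i,\mathbf{x}_j\rangle$. Problem (P): minimize $f(\mathbf{z})$ subject to $\mathbf{x}_i\in\Omega_i^+$ for $i=1,\dots,n$ and $\langle\mathbf{x}_i,\mathbf{x}_j\rangle=0$ for all $i\ne j$. $S^{\mathrm{opt}}$ is its set of (global) optimal solutions. Problem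 (P$_\beta$), for $\beta\in\mathbb{R}$: minimize $f_\beta(\mathbf{z})=f(\mathbf{z})+\beta p(\mathbf{z})$ subject to $\mathbf{z}\in\Omega$. $S_\beta^{\mathrm{opt}}$ is its set of (global) optimal solutions. $\bar\Omega$ denotes the set of extreme points of $\Omega$, and $\bar S_\beta^{\mathrm{opt}}=\bar\Omega\cap S_\beta^{\mathrm{opt}}$.
   Formalization: The existence of β̄ is stated under the added assumption that (P) is feasible; otherwise S^opt is empty but the extreme optimal set of (P_β) is not, so ( * ) fails (e.g. m=1, n=2, Ω_1=Ω_2={1}, f=0). *)

theory Defs
  imports "HOL-Analysis.Analysis"
begin

text \<open>
  A point of \<open>R^(mn)\<close> is a vector of blocks \<open>z :: real^'m^'n\<close>, the \<open>i\<close>-th block being \<open>z $ i\<close>.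
  The index type \<open>'n\<close> carries a linear order so that sums over pairs \<open>i < j\<close> make sense.
\<close>

definition block_update :: "'a^'n \<Rightarrow> 'n \<Rightarrow> 'a \<Rightarrow> 'a^'n" where
  "block_update z i x = (\<chi> j. if j = i then x else z $ j)"

definition multi_affine :: "(real^'m^'n \<Rightarrow> real) \<Rightarrow> bool" where
  "multi_affine f \<longleftrightarrow>
     (\<forall>i z. \<exists>g c. linear g \<and> (\<forall>x. f (block_update z i x) = g x + c))"

definition nonneg_part :: "(real^'m) set \<Rightarrow> (real^'m) set" where
  "nonneg_part A = A \<inter> {x. \<forall>k. 0 \<le> x $ k}"

definition prod_region :: "('n \<Rightarrow> (real^'m) set) \<Rightarrow> (real^'m^'n) set" where
  "prod_region Om = {z. \<forall>i. z $ i \<in> nonneg_part (Om i)}"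

definition penalty :: "real^'m^'n::{finite,linorder} \<Rightarrow> real" where
  "penalty z = (\<Sum>i\<in>UNIV. \<Sum>j\<in>{j. j > i}. z $ i \<bullet> z $ j)"

definition feasible_P :: "('n \<Rightarrow> (real^'m) set) \<Rightarrow> (real^'m^'n) set" where
  "feasible_P Om =
     {z. (\<forall>i. z $ i \<in> nonneg_part (Om i)) \<and> (\<forall>i j. i \<noteq> j \<longrightarrow> z $ i \<bullet> z $ j = 0)}"

definition S_opt :: "(real^'m^'n \<Rightarrow> real) \<Rightarrow> ('n \<Rightarrow> (real^'m) set) \<Rightarrow> (real^'m^'n) set" where
  "S_opt f Om = {z. is_arg_min f (\<lambda>y. y \<in> feasible_P Om) z}"

definition penalized ::
  "(real^'m^'n::{finite,linorder} \<Rightarrow> real) \<Rightarrow> real \<Rightarrow> real^'m^'n::{finite,linorder} \<Rightarrow> real" where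
  "penalized f \<beta> z = f z + \<beta> * penalty z"

definition S_opt_pen ::
  "(real^'m^'n::{finite,linorder} \<Rightarrow> real) \<Rightarrow> ('n \<Rightarrow> (real^'m) set) \<Rightarrow> real \<Rightarrow> (real^'m^'n::{finite,linorder}) set" where
  "S_opt_pen f Om \<beta> = {z. is_arg_min (penalized f \<beta>) (\<lambda>y. y \<in> prod_region Om) z}"

definition ext_S_opt_pen ::
  "(real^'m^'n::{finite,linorder} \<Rightarrow> real) \<Rightarrow> ('n \<Rightarrow> (real^'m) set) \<Rightarrow> real \<Rightarrow> (real^'m^'n::{finite,linorder}) set" where
  "ext_S_opt_pen f Om \<beta> = {z. z extreme_point_of prod_region Om} \<inter> S_opt_pen f Om \<beta>"

definition penalty_sandwich ::
  "(real^'m^'n::{finite,linorder} \<Rightarrow> real) \<Rightarrow> ('n \<Rightarrow> (real^'m) set) \<Rightarrow> real \<Rightarrow> bool" where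
  "penalty_sandwich f Om b \<longleftrightarrow>
     (\<forall>\<beta>\<ge>b. ext_S_opt_pen f Om \<beta> \<subseteq> S_opt f Om \<and> S_opt f Om \<subseteq> S_opt_pen f Om \<beta>)"

text \<open>
  If the complementarity-constrained problem is infeasible, then \<open>S_opt f Om\<close> is empty while
  \<open>ext_S_opt_pen f Om \<beta>\<close> is not, so no threshold satisfies \<open>penalty_sandwich\<close>
  (for instance \<open>m = 1\<close>, \<open>n = 2\<close> and both sets equal to \<open>{1}\<close>).  An existence claim for the
  threshold therefore needs \<open>feasible_P Om \<noteq> {}\<close>.
\<close>

end

theory Submission
  imports Defs
begin

text \<open>
  An affine function on a polytope does not exceed its value at a given point in some vertex, and
  ties can be broken by a second affine function. Moving the blocks to vertices one at a time
  therefore takes any point of \<open>\<Omega>\<close> to an extreme point that lexicographically improves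
  two given multi-affine functions. Since \<open>\<Omega>\<close> has finitely many extreme points, a large
  \<open>\<beta>\<close> makes those with positive penalty worse than a fixed feasible point; this yields the
  sandwich. For the equality, break ties in \<open>f\<^sub>\<beta>\<close> by the penalty: a minimizer of
  \<open>f\<^sub>\<beta>\<close> has at most the penalty of some extreme minimizer, which is zero.
\<close>

section \<open>Closure properties of multi-affine functions\<close>

lemma block_update_nth [simp]: "block_update z i x $ j = (if j = i then x else z $ j)"
  by (simp add: block_update_def)

lemma block_update_self [simp]: "block_update z i (z $ i) = z"
  by (simp add: vec_eq_iff)

lemma multi_affineE:
  assumes "multi_affine f"
  obtains g c where "linear g" "\<And>x. f (block_update z i x) = g x + c"
  using assms unfolding multi_affine_def by meson

lemma multi_affine_add:
  assumes "multi_affine f" "multi_affine g"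
  shows "multi_affine (\<lambda>z. f z + g z)"
  unfolding multi_affine_def
proof (intro allI)
  fix i z
  obtain f' c where f: "linear f'" "\<And>x. f (block_update z i x) = f' x + c"
    using assms(1) by (rule multi_affineE[where i = i and z = z]) blast
  obtain g' d where g: "linear g'" "\<And>x. g (block_update z i x) = g' x + d"
    using assms(2) by (rule multi_affineE[where i = i and z = z]) blast
  have "linear (\<lambda>x. f' x + g' x)"
    using f(1) g(1) by (rule linear_compose_add)
  moreover have "\<forall>x. f (block_update z i x) + g (block_update z i x) = (f' x + g' x) + (c + d)"
    by (simp add: f(2) g(2))
  ultimately show "\<exists>h e. linear h \<and>
      (\<forall>x. f (block_update z i x) + g (block_update z i x) = h x + e)"
    by blast
qed

lemma multi_affine_cmult:
  assumes "multi_affine f"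
  shows "multi_affine (\<lambda>z. r * f z)"
  unfolding multi_affine_def
proof (intro allI)
  fix i z
  obtain g c where g: "linear g" "\<And>x. f (block_update z i x) = g x + c"
    using assms by (rule multi_affineE[where i = i and z = z]) blast
  have "linear (\<lambda>x. r * g x)"
    using linear_compose_scale_right[OF g(1), of r] by simp
  moreover have "\<forall>x. r * f (block_update z i x) = r * g x + r * c"
    by (simp add: g(2) distrib_left)
  ultimately show "\<exists>h e. linear h \<and> (\<forall>x. r * f (block_update z i x) = h x + e)"
    by blast
qed

lemma multi_affine_zero: "multi_affine (\<lambda>z. 0)"
  unfolding multi_affine_def by (metis add.right_neutral module_hom_zero)

lemma multi_affine_sum:
  assumes "\<And>a. a \<in> A \<Longrightarrow> multi_affine (F a)"
  shows "multi_affine (\<lambda>z. \<Sum>a\<in>A. F a z)"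
  using assms
  by (induction A rule: infinite_finite_induct)
    (simp_all add: multi_affine_zero multi_affine_add)

text \<open>As the two indices differ, an update reaches at most one factor of the bilinear product;
  for \<open>i = j\<close> the dependence would be quadratic.\<close>

lemma multi_affine_inner:
  fixes i j :: "'n::finite"
  assumes "i \<noteq> j"
  shows "multi_affine (\<lambda>z::real^'m^'n. z $ i \<bullet> z $ j)"
  unfolding multi_affine_def
proof (intro allI)
  fix k and z :: "real^'m^'n"
  have lin: "linear (\<lambda>x. x \<bullet> w)" "linear (\<lambda>x. w \<bullet> x)" for w :: "real^'m"
    by (simp_all add: bounded_linear.linear bounded_linear_inner_left bounded_linear_inner_right)
  consider "k = i" | "k = j" | "k \<noteq> i" "k \<noteq> j" by blast
  then show "\<exists>g c. linear g \<and> (\<forall>x. block_update z k x $ i \<bullet> block_update z k x $ j = g x + c)"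
  proof cases
    case 1
    show ?thesis
      by (rule exI[of _ "\<lambda>x. x \<bullet> z $ j"], rule exI[of _ 0]) (use 1 assms lin in auto)
  next
    case 2
    show ?thesis
      by (rule exI[of _ "\<lambda>x. z $ i \<bullet> x"], rule exI[of _ 0]) (use 2 assms lin in auto)
  next
    case 3
    show ?thesis
      by (rule exI[of _ "\<lambda>x. 0"], rule exI[of _ "z $ i \<bullet> z $ j"]) (use 3 in \<open>auto simp: linear_zero\<close>)
  qed
qed

lemma multi_affine_penalty: "multi_affine penalty"
  unfolding penalty_def[abs_def]
  by (intro multi_affine_sum multi_affine_inner) auto

lemma multi_affine_penalized:
  "multi_affine f \<Longrightarrow> multi_affine (penalized f \<beta>)"
  unfolding penalized_def[abs_def]
  by (intro multi_affine_add multi_affine_cmult multi_affine_penalty)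

section \<open>The penalty on the nonnegative orthant\<close>

lemma nonneg_part_inner_nonneg:
  "x \<in> nonneg_part A \<Longrightarrow> y \<in> nonneg_part B \<Longrightarrow> 0 \<le> x \<bullet> y"
  by (auto simp: nonneg_part_def inner_vec_def intro!: sum_nonneg)

lemma penalty_nonneg: "z \<in> prod_region Om \<Longrightarrow> 0 \<le> penalty z"
  unfolding penalty_def prod_region_def
  by (auto intro!: sum_nonneg intro: nonneg_part_inner_nonneg)

text \<open>On \<open>prod_region Om\<close> every summand of the penalty is nonnegative, so the sum
  vanishes only if each summand does. Symmetry of the inner product carries this from
  \<open>i < j\<close> to all \<open>i \<noteq> j\<close>.\<close>

lemma feasible_P_iff_penalty:
  "z \<in> feasible_P Om \<longleftrightarrow> z \<in> prod_region Om \<and> penalty z = 0"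
proof
  assume "z \<in> feasible_P Om"
  then show "z \<in> prod_region Om \<and> penalty z = 0"
    unfolding feasible_P_def prod_region_def penalty_def
    by (auto intro!: sum.neutral)
next
  assume z: "z \<in> prod_region Om \<and> penalty z = 0"
  have nonneg: "0 \<le> z $ i \<bullet> z $ j" for i j
    using z by (auto simp: prod_region_def intro: nonneg_part_inner_nonneg)
  then have "\<forall>i. (\<Sum>j\<in>{j. j > i}. z $ i \<bullet> z $ j) = 0"
    using z by (simp add: penalty_def sum_nonneg_eq_0_iff sum_nonneg)
  then have less: "z $ i \<bullet> z $ j = 0" if "i < j" for i j
    using nonneg that by (simp add: sum_nonneg_eq_0_iff)
  have "z $ i \<bullet> z $ j = 0" if "i \<noteq> j" for i j
    using less[of i j] less[of j i] that by (cases i j rule: linorder_cases) (auto simp: inner_commute)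
  then show "z \<in> feasible_P Om"
    using z by (simp add: feasible_P_def prod_region_def)
qed

section \<open>Factors and extreme points of the product region\<close>

lemma polyhedron_nonneg_orthant: "polyhedron {x::real^'m. \<forall>k. 0 \<le> x $ k}"
proof -
  have "{x::real^'m. \<forall>k. 0 \<le> x $ k} = \<Inter> (range (\<lambda>k. {x. axis k 1 \<bullet> x \<ge> 0}))"
    by (auto simp: inner_axis')
  then show ?thesis
    by (auto intro!: polyhedron_Inter simp: polyhedron_halfspace_ge)
qed

lemma polyhedron_nonneg_part: "polyhedron A \<Longrightarrow> polyhedron (nonneg_part A)"
  unfolding nonneg_part_def by (rule polyhedron_Int[OF _ polyhedron_nonneg_orthant])

text \<open>Each factor is a coordinate projection of the product. Surjectivity of the projection
  takes a point \<open>z0\<close> that fills the remaining blocks.\<close>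

lemma compact_factor:
  fixes Om :: "'n::finite \<Rightarrow> (real^'m) set"
  assumes "prod_region Om \<noteq> {}" "compact (prod_region Om)"
  shows "compact (nonneg_part (Om i))"
proof -
  obtain z0 where z0: "z0 \<in> prod_region Om"
    using assms(1) by blast
  have "(\<lambda>z. z $ i) ` prod_region Om = nonneg_part (Om i)"
  proof
    show "nonneg_part (Om i) \<subseteq> (\<lambda>z. z $ i) ` prod_region Om"
      using z0 by (auto simp: prod_region_def intro!: image_eqI[where x = "block_update z0 i _"])
  qed (auto simp: prod_region_def)
  moreover have "compact ((\<lambda>z. z $ i) ` prod_region Om)"
    by (intro compact_continuous_image continuous_intros assms(2))
  ultimately show ?thesis
    by simp
qed

text \<open>A segment through one block lifts to the product with the other blocks held fixed;
  conversely, a segment in the product with distinct endpoints is nondegenerate in some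
  block.\<close>

lemma extreme_point_prod_region:
  fixes Om :: "'n::finite \<Rightarrow> (real^'m) set"
  shows "z extreme_point_of prod_region Om \<longleftrightarrow> (\<forall>i. z $ i extreme_point_of nonneg_part (Om i))"
proof
  assume z: "z extreme_point_of prod_region Om"
  show "\<forall>i. z $ i extreme_point_of nonneg_part (Om i)"
  proof
    fix i
    have "z $ i \<notin> open_segment a b"
      if ab: "a \<in> nonneg_part (Om i)" "b \<in> nonneg_part (Om i)" for a b
    proof
      assume "z $ i \<in> open_segment a b"
      then obtain u where u: "a \<noteq> b" "0 < u" "u < 1" "z $ i = (1 - u) *\<^sub>R a + u *\<^sub>R b"
        by (auto simp: in_segment)
      have "block_update z i a \<noteq> block_update z i b"
        using u(1) by (auto simp: vec_eq_iff dest: spec[of _ i])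
      moreover have "z = (1 - u) *\<^sub>R block_update z i a + u *\<^sub>R block_update z i b"
        using u(4) by (subst vec_eq_iff) (auto simp: algebra_simps)
      ultimately have "z \<in> open_segment (block_update z i a) (block_update z i b)"
        using u(2,3) by (auto simp: in_segment)
      moreover have "block_update z i a \<in> prod_region Om" "block_update z i b \<in> prod_region Om"
        using z ab by (auto simp: extreme_point_of_def prod_region_def)
      ultimately show False
        using z by (auto simp: extreme_point_of_def)
    qed
    moreover have "z $ i \<in> nonneg_part (Om i)"
      using z by (auto simp: extreme_point_of_def prod_region_def)
    ultimately show "z $ i extreme_point_of nonneg_part (Om i)"
      by (auto simp: extreme_point_of_def)
  qed
next
  assume z: "\<forall>i. z $ i extreme_point_of nonneg_part (Om i)"
  have "z \<notin> open_segment a b" if ab: "a \<in> prod_region Om" "b \<in> prod_region Om" for a b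
  proof
    assume "z \<in> open_segment a b"
    then obtain u where u: "a \<noteq> b" "0 < u" "u < 1" "z = (1 - u) *\<^sub>R a + u *\<^sub>R b"
      by (auto simp: in_segment)
    obtain i where "a $ i \<noteq> b $ i"
      using u(1) by (auto simp: vec_eq_iff)
    then have "z $ i \<in> open_segment (a $ i) (b $ i)"
      using u(2-4) by (auto simp: in_segment)
    then show False
      using z ab by (auto simp: extreme_point_of_def prod_region_def)
  qed
  then show "z extreme_point_of prod_region Om"
    using z by (auto simp: extreme_point_of_def prod_region_def)
qed

lemma finite_extreme_points_prod_region:
  fixes Om :: "'n::finite \<Rightarrow> (real^'m) set"
  assumes "\<And>i. polyhedron (Om i)"
  shows "finite {z. z extreme_point_of prod_region Om}"
proof -
  let ?F = "PiE UNIV (\<lambda>i. {x. x extreme_point_of nonneg_part (Om i)})"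
  have "finite ?F"
    using assms
    by (intro finite_PiE finite_polyhedron_extreme_points polyhedron_nonneg_part) auto
  then have "finite (vec_lambda ` ?F)"
    by (rule finite_imageI)
  moreover have "{z. z extreme_point_of prod_region Om} \<subseteq> vec_lambda ` ?F"
    by (auto simp: extreme_point_prod_region intro!: image_eqI[where x = "vec_nth _"])
  ultimately show ?thesis
    by (rule rev_finite_subset)
qed

section \<open>Lexicographic descent to extreme points\<close>

text \<open>
  The vertices violating the claim lie in the lexicographically worse set \<open>W\<close>, which is
  convex although neither open nor closed; so \<open>W\<close> would contain the whole hull.
\<close>

lemma convex_hull_lex_improvement:
  fixes g q :: "'a::real_vector \<Rightarrow> real"
  assumes "linear g" "linear q" and x: "x \<in> convex hull E"
  shows "\<exists>e\<in>E. g e < g x \<or> (g e = g x \<and> q x \<le> q e)"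
proof (rule ccontr)
  define W where "W = {y. g x < g y \<or> (g y = g x \<and> q y < q x)}"
  assume "\<not> ?thesis"
  then have "E \<subseteq> W"
    unfolding W_def by force
  moreover have "convex W"
    unfolding convex_alt
  proof (intro ballI allI impI)
    fix a b u
    assume ab: "a \<in> W" "b \<in> W" and u: "0 \<le> u \<and> u \<le> (1::real)"
    let ?y = "(1 - u) *\<^sub>R a + u *\<^sub>R b"
    have g: "g ?y = (1 - u) * g a + u * g b" and q: "q ?y = (1 - u) * q a + u * q b"
      using assms(1,2) by (simp_all add: linear_add linear_scale)
    \<comment> \<open>The strict estimates below need both weights positive, so the endpoints are
      split off.\<close>
    consider "u = 0" | "u = 1" | "0 < u" "u < 1"
      using u by fastforce
    then show "?y \<in> W"
    proof cases
      case 3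
      have ge: "g x \<le> g a" "g x \<le> g b"
        using ab by (auto simp: W_def)
      show ?thesis
      \<comment> \<open>If both endpoints tie with \<open>x\<close> under \<open>g\<close>,
        strictness comes from \<open>q\<close>; otherwise one endpoint is strictly larger under
        \<open>g\<close> and its positive weight makes \<open>g\<close> strict.\<close>
      proof (cases "g x = g a \<and> g x = g b")
        case True
        then have "q a < q x" "q b < q x"
          using ab by (auto simp: W_def)
        then have "(1 - u) * q a + u * q b < q x"
          using 3 by (intro convex_bound_lt) auto
        moreover have "g ?y = g x"
          using True unfolding g by (metis add.commute diff_add_cancel distrib_right mult_1)
        ultimately show ?thesis
          unfolding W_def using q by simp
      next
        case False
        then have "0 < (1 - u) * (g a - g x) + u * (g b - g x)"
          using ge 3 by (cases "g x = g a") (simp_all add: add_pos_nonneg)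
        then have "g x < g ?y"
          unfolding g by (simp add: algebra_simps)
        then show ?thesis
          by (simp add: W_def)
      qed
    qed (use ab in auto)
  qed
  ultimately have "convex hull E \<subseteq> W"
    by (rule hull_minimal)
  then show False
    using x by (auto simp: W_def)
qed

text \<open>Induction on the set \<open>A\<close> of blocks already moved to vertices. With the
  other blocks frozen, \<open>g\<close> and \<open>q\<close> are affine in block \<open>k\<close>,
  and lexicographic improvements compose. Note the directions: \<open>g\<close> goes down, while a
  tie is broken by \<open>q\<close> going up.\<close>

lemma extreme_point_lex_improvement:
  fixes Om :: "'n::finite \<Rightarrow> (real^'m) set"
  assumes g: "multi_affine g" and q: "multi_affine q"
    and poly: "\<And>i. polyhedron (Om i)" and comp: "compact (prod_region Om)"
    and z: "z \<in> prod_region Om"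
  obtains v where "v extreme_point_of prod_region Om" "g v < g z \<or> (g v = g z \<and> q z \<le> q v)"
proof -
  have "\<exists>v \<in> prod_region Om. (\<forall>i\<in>A. v $ i extreme_point_of nonneg_part (Om i)) \<and>
      (g v < g z \<or> (g v = g z \<and> q z \<le> q v))" if "finite A" for A
    using that
  proof (induction A rule: finite_induct)
    case empty
    then show ?case
      using z by auto
  next
    case (insert k A)
    then obtain v where v: "v \<in> prod_region Om" "\<forall>i\<in>A. v $ i extreme_point_of nonneg_part (Om i)"
      "g v < g z \<or> (g v = g z \<and> q z \<le> q v)"
      by blast
    obtain g' c where g': "linear g'" "\<And>x. g (block_update v k x) = g' x + c"
      using g by (rule multi_affineE[where i = k and z = v]) blast
    obtain q' d where q': "linear q'" "\<And>x. q (block_update v k x) = q' x + d"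
      using q by (rule multi_affineE[where i = k and z = v]) blast
    have gv: "g v = g' (v $ k) + c" and qv: "q v = q' (v $ k) + d"
      using g'(2)[of "v $ k"] q'(2)[of "v $ k"] by simp_all
    \<comment> \<open>Compactness makes the factor the hull of its vertices; an unbounded polyhedron
      may have none.\<close>
    have "compact (nonneg_part (Om k))" "convex (nonneg_part (Om k))"
      using compact_factor[OF _ comp] z polyhedron_nonneg_part[OF poly]
      by (auto intro: polyhedron_imp_convex)
    then have "nonneg_part (Om k) = convex hull {x. x extreme_point_of nonneg_part (Om k)}"
      by (rule Krein_Milman_Minkowski)
    moreover have "v $ k \<in> nonneg_part (Om k)"
      using v(1) by (auto simp: prod_region_def)
    ultimately have "v $ k \<in> convex hull {x. x extreme_point_of nonneg_part (Om k)}"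
      by simp
    from convex_hull_lex_improvement[OF g'(1) q'(1) this] obtain e
      where e: "e extreme_point_of nonneg_part (Om k)"
        "g' e < g' (v $ k) \<or> (g' e = g' (v $ k) \<and> q' (v $ k) \<le> q' e)"
      by auto
    let ?w = "block_update v k e"
    have "?w \<in> prod_region Om"
      using v(1) e(1) by (auto simp: prod_region_def extreme_point_of_def)
    moreover have "\<forall>i\<in>insert k A. ?w $ i extreme_point_of nonneg_part (Om i)"
      using v(2) e(1) by auto
    moreover have "g ?w < g z \<or> (g ?w = g z \<and> q z \<le> q ?w)"
      using v(3) e(2) unfolding g'(2) q'(2) gv qv by linarith
    ultimately show ?case
      by blast
  qed
  from this[of UNIV] show ?thesis
    using that by (auto simp: extreme_point_prod_region)
qed

section \<open>Minimizers of the penalized problem and the threshold\<close>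

lemma ext_S_opt_pen_nonempty:
  fixes f :: "real^'m^'n::{finite,linorder} \<Rightarrow> real"
  assumes f: "multi_affine f" and poly: "\<And>i. polyhedron (Om i)"
    and ne: "prod_region Om \<noteq> {}" and comp: "compact (prod_region Om)"
  shows "ext_S_opt_pen f Om \<beta> \<noteq> {}"
proof -
  let ?V = "{z. z extreme_point_of prod_region Om}"
  let ?g = "penalized f \<beta>"
  \<comment> \<open>Only the first function matters here, so the tie-breaker is the zero
    function.\<close>
  have better: "\<exists>v\<in>?V. ?g v \<le> ?g z" if "z \<in> prod_region Om" for z
    using extreme_point_lex_improvement[OF multi_affine_penalized[OF f, of \<beta>]
        multi_affine_zero poly comp that]
    by (metis less_imp_le mem_Collect_eq order_refl)
  have fin: "finite ?V"
    by (rule finite_extreme_points_prod_region[OF poly])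
  moreover have "?V \<noteq> {}"
    using better ne by blast
  ultimately obtain v where v: "v \<in> ?V" "\<And>w. w \<in> ?V \<Longrightarrow> ?g v \<le> ?g w"
    by (metis arg_min_if_finite(1) arg_min_least)
  have "?g v \<le> ?g z" if "z \<in> prod_region Om" for z
    using better[OF that] v(2) by force
  then have "v \<in> ext_S_opt_pen f Om \<beta>"
    using v(1) by (auto simp: ext_S_opt_pen_def S_opt_pen_def is_arg_min_linorder extreme_point_of_def)
  then show ?thesis
    by blast
qed

text \<open>\<open>feasible_P Om\<close> lies in \<open>prod_region Om\<close>, and on it the
  penalized objective coincides with \<open>f\<close>.\<close>

lemma S_opt_pen_feasible_imp_S_opt:
  assumes "z \<in> S_opt_pen f Om \<beta>" "z \<in> feasible_P Om"
  shows "z \<in> S_opt f Om"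
  using assms
  by (force simp: S_opt_pen_def S_opt_def is_arg_min_linorder penalized_def feasible_P_iff_penalty)

lemma exists_penalty_sandwich:
  fixes f :: "real^'m^'n::{finite,linorder} \<Rightarrow> real"
  assumes f: "multi_affine f" and poly: "\<And>i. polyhedron (Om i)"
    and comp: "compact (prod_region Om)" and feas: "feasible_P Om \<noteq> {}"
  shows "\<exists>b>0. penalty_sandwich f Om b"
proof -
  let ?V = "{z. z extreme_point_of prod_region Om}"
  obtain z0 where z0: "z0 \<in> feasible_P Om"
    using feas by blast
  \<comment> \<open>For positive penalty, the quotient is the multiplier at which \<open>v\<close>
    ties with the feasible point \<open>z0\<close>. For zero penalty, division yields the harmless
    default 0.\<close>
  define B where "B = (\<lambda>v. (f z0 - f v) / penalty v) ` ?V"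
  have fin: "finite B"
    unfolding B_def by (intro finite_imageI finite_extreme_points_prod_region poly)
  \<comment> \<open>Inserting 0 makes the maximum well defined and nonnegative; adding 1 makes both
    bounds strict.\<close>
  define b where "b = Max (insert 0 B) + 1"
  have b: "b > 0" "\<And>v. v \<in> ?V \<Longrightarrow> (f z0 - f v) / penalty v < b"
  proof -
    have le: "t \<le> Max (insert 0 B)" if "t \<in> insert 0 B" for t
      using that fin by (intro Max_ge) auto
    show "b > 0"
      using le[of 0] by (simp add: b_def)
    show "(f z0 - f v) / penalty v < b" if "v \<in> ?V" for v
      using le[of "(f z0 - f v) / penalty v"] that by (auto simp: b_def B_def)
  qed
  have "ext_S_opt_pen f Om \<beta> \<subseteq> S_opt f Om \<and> S_opt f Om \<subseteq> S_opt_pen f Om \<beta>" if \<beta>: "b \<le> \<beta>" for \<beta>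
  proof
    show ext: "ext_S_opt_pen f Om \<beta> \<subseteq> S_opt f Om"
    proof
      fix v
      assume v: "v \<in> ext_S_opt_pen f Om \<beta>"
      then have vV: "v \<in> ?V" and opt: "v \<in> S_opt_pen f Om \<beta>" and vO: "v \<in> prod_region Om"
        by (auto simp: ext_S_opt_pen_def extreme_point_of_def)
      have "penalty v = 0"
      proof (rule ccontr)
        assume "penalty v \<noteq> 0"
        then have pos: "penalty v > 0"
          using penalty_nonneg[OF vO] by simp
        then have "f z0 < f v + b * penalty v"
          using b(2)[OF vV] by (simp add: pos_divide_less_eq)
        also have "\<dots> \<le> f v + \<beta> * penalty v"
          using pos \<beta> by simp
        also have "\<dots> \<le> f z0"
          using opt z0 by (auto simp: S_opt_pen_def is_arg_min_linorder penalized_def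
              feasible_P_iff_penalty dest!: spec[of _ z0])
        finally show False
          by simp
      qed
      then show "v \<in> S_opt f Om"
        using S_opt_pen_feasible_imp_S_opt[OF opt] vO by (simp add: feasible_P_iff_penalty)
    qed
    have "prod_region Om \<noteq> {}"
      using z0 by (auto simp: feasible_P_iff_penalty)
    \<comment> \<open>An extreme minimizer \<open>v\<close> links the two problems: every point of
      \<open>S_opt f Om\<close> has zero penalty and the same \<open>f\<close>-value as
      \<open>v\<close>, hence attains the penalized minimum.\<close>
    then obtain v where v: "v \<in> ext_S_opt_pen f Om \<beta>"
      using ext_S_opt_pen_nonempty[OF f poly _ comp] by blast
    then have "v \<in> S_opt_pen f Om \<beta>" "v \<in> S_opt f Om"
      using ext by (auto simp: ext_S_opt_pen_def)
    then show "S_opt f Om \<subseteq> S_opt_pen f Om \<beta>"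
      by (force simp: S_opt_def S_opt_pen_def is_arg_min_linorder penalized_def
          feasible_P_iff_penalty)
  qed
  then show ?thesis
    using b(1) unfolding penalty_sandwich_def by blast
qed

text \<open>The inclusions at the single value \<beta> suffice. Descent from a minimizer
  \<open>z\<close> cannot lower the objective, so it ends at an extreme minimizer \<open>v\<close>
  whose penalty bounds that of \<open>z\<close> from above; the penalty of \<open>v\<close> is zero,
  hence \<open>z\<close> is feasible.\<close>

lemma S_opt_pen_eq_S_opt:
  fixes f :: "real^'m^'n::{finite,linorder} \<Rightarrow> real"
  assumes f: "multi_affine f" and poly: "\<And>i. polyhedron (Om i)"
    and comp: "compact (prod_region Om)"
    and ext: "ext_S_opt_pen f Om \<beta> \<subseteq> S_opt f Om" and opt: "S_opt f Om \<subseteq> S_opt_pen f Om \<beta>"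
  shows "S_opt_pen f Om \<beta> = S_opt f Om"
proof
  show "S_opt_pen f Om \<beta> \<subseteq> S_opt f Om"
  proof
    fix z
    assume z: "z \<in> S_opt_pen f Om \<beta>"
    then have zO: "z \<in> prod_region Om"
      and min: "\<And>y. y \<in> prod_region Om \<Longrightarrow> penalized f \<beta> z \<le> penalized f \<beta> y"
      by (auto simp: S_opt_pen_def is_arg_min_linorder)
    obtain v where v: "v extreme_point_of prod_region Om"
      "penalized f \<beta> v < penalized f \<beta> z \<or>
       (penalized f \<beta> v = penalized f \<beta> z \<and> penalty z \<le> penalty v)"
      using extreme_point_lex_improvement[OF multi_affine_penalized[OF f]
          multi_affine_penalty poly comp zO] by blast
    have vO: "v \<in> prod_region Om"
      using v(1) by (simp add: extreme_point_of_def)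
    then have eq: "penalized f \<beta> v = penalized f \<beta> z" "penalty z \<le> penalty v"
      using v(2) min[of v] by auto
    then have "v \<in> ext_S_opt_pen f Om \<beta>"
      using v(1) vO min by (auto simp: ext_S_opt_pen_def S_opt_pen_def is_arg_min_linorder)
    then have "v \<in> S_opt f Om"
      using ext by blast
    then have "penalty v = 0"
      by (auto simp: S_opt_def is_arg_min_linorder feasible_P_iff_penalty)
    then have "z \<in> feasible_P Om"
      using eq(2) penalty_nonneg[OF zO] zO by (simp add: feasible_P_iff_penalty)
    with z show "z \<in> S_opt f Om"
      by (rule S_opt_pen_feasible_imp_S_opt)
  qed
qed (fact opt)

theorem theorem3:
  fixes f :: "real^'m^'n::{finite,linorder} \<Rightarrow> real"
    and Om :: "'n \<Rightarrow> (real^'m) set"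
  assumes "CARD('n) \<ge> 2"
    and "multi_affine f"
    and "\<And>i. polyhedron (Om i)"
    and "prod_region Om \<noteq> {}"
    and "compact (prod_region Om)"
  shows "(feasible_P Om \<noteq> {} \<longrightarrow> (\<exists>b>0. penalty_sandwich f Om b)) \<and>
         (\<forall>b>0. penalty_sandwich f Om b \<longrightarrow> (\<forall>\<beta>\<ge>b. S_opt_pen f Om \<beta> = S_opt f Om))"
  using exists_penalty_sandwich[OF assms(2,3,5)] S_opt_pen_eq_S_opt[OF assms(2,3,5)]
  by (simp add: penalty_sandwich_def)

end
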